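(* Assume $\diamondsuit$. Then there exists a set $X\subseteq 2^\omega$ which is a hereditarily $\gamma$-set (every subset of $X$ is a $\gamma$-set) and which is not strongly meager, i.e. there is a null set $G\subseteq 2^\omega$ with $X+G=2^\omega$.
   Context: $2^\omega$ carries the product topology, the product (coin-tossing) measure, and the group operation $+$ given by coordinatewise addition mod $2$; $X+G=\{x+g : x\in X, g\in G\}$. A family $\mathcal J$ of subsets of $Y$ is an $\omega$-cover of $Y$ if for every finite $F\subseteq Y$ there is $B\in\mathcal J$ with $F\subseteq B$. A subset $Y\subseteq 2^\omega$ (with the subspace topology) is a $\gamma$-set if for every $\omega$-cover $\mathcal J$ of $Y$ consisting of open sets there is a sequence $\{D_n:n\in\omega\}\subseteq\mathcal J$ with $Y\subseteq\bigcup_m\bigcap_{n>m}D_n$. A set $X\subseteq 2^\omega$ is strongly meager if for every null set $G\subseteq 2^\omega$, $X+G\neq 2^\omega$. $\diamondsuit$ is Jensen's diamond principle. *)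

theory Defs
  imports "HOL-Probability.Probability"
begin

text \<open>
  Points of \<open>2\<^sup>\<omega>\<close> are functions \<open>nat \<Rightarrow> bool\<close>; its topology is the library's product
  topology on functions, with \<^typ>\<open>bool\<close> discrete.
\<close>

text \<open>Addition mod 2 on \<^typ>\<open>bool\<close> is exclusive or, i.e. \<open>\<noteq>\<close>.\<close>

definition cantor_add :: "(nat \<Rightarrow> bool) \<Rightarrow> (nat \<Rightarrow> bool) \<Rightarrow> (nat \<Rightarrow> bool)"
  where "cantor_add x g = (\<lambda>n. x n \<noteq> g n)"

definition cantor_sumset :: "(nat \<Rightarrow> bool) set \<Rightarrow> (nat \<Rightarrow> bool) set \<Rightarrow> (nat \<Rightarrow> bool) set"
  where "cantor_sumset X G = {cantor_add x g | x g. x \<in> X \<and> g \<in> G}"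

definition cantor_measure :: "(nat \<Rightarrow> bool) measure"
  where "cantor_measure = (\<Pi>\<^sub>M n\<in>(UNIV :: nat set). measure_pmf (bernoulli_pmf (1/2)))"

text \<open>
  Null sets need not be Borel, so they are taken in the completion.
\<close>

definition cantor_null :: "(nat \<Rightarrow> bool) set \<Rightarrow> bool"
  where "cantor_null G \<longleftrightarrow> G \<in> null_sets (completion cantor_measure)"

definition strongly_meager :: "(nat \<Rightarrow> bool) set \<Rightarrow> bool"
  where "strongly_meager X \<longleftrightarrow> (\<forall>G. cantor_null G \<longrightarrow> cantor_sumset X G \<noteq> UNIV)"

definition omega_cover :: "'a set set \<Rightarrow> 'a set \<Rightarrow> bool"
  where "omega_cover \<J> Y \<longleftrightarrow>
    (\<forall>B\<in>\<J>. B \<subseteq> Y) \<and> (\<forall>F. finite F \<and> F \<subseteq> Y \<longrightarrow> (\<exists>B\<in>\<J>. F \<subseteq> B))"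

definition gamma_set :: "'a::topological_space set \<Rightarrow> bool"
  where "gamma_set Y \<longleftrightarrow>
    (\<forall>\<J>. omega_cover \<J> Y \<and> (\<forall>B\<in>\<J>. openin (top_of_set Y) B) \<longrightarrow>
      (\<exists>D :: nat \<Rightarrow> 'a set. range D \<subseteq> \<J> \<and> Y \<subseteq> (\<Union>m. \<Inter>n\<in>{m<..}. D n)))"

definition hereditarily_gamma_set :: "'a::topological_space set \<Rightarrow> bool"
  where "hereditarily_gamma_set X \<longleftrightarrow> (\<forall>Y\<subseteq>X. gamma_set Y)"

text \<open>
  The ordinal \<open>\<omega>\<^sub>1\<close> is represented by the library's successor cardinal of \<open>\<aleph>\<^sub>0\<close>, a well-order
  (as a reflexive relation) of type \<open>\<omega>\<^sub>1\<close>. An ordinal \<open>\<alpha> < \<omega>\<^sub>1\<close> is an element of its field, and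
  \<open>\<alpha>\<close> as the set of smaller ordinals is \<open>underS omega1 \<alpha>\<close>.
\<close>

abbreviation omega1 :: "nat set rel"
  where "omega1 \<equiv> cardSuc natLeq"

text \<open>
  In the closure clause, \<open>C\<close> being strictly cofinal below a nonzero \<open>\<alpha>\<close> forces \<open>\<alpha>\<close> to be a limit.
\<close>

definition club_omega1 :: "nat set set \<Rightarrow> bool"
  where "club_omega1 C \<longleftrightarrow>
    C \<subseteq> Field omega1 \<and>
    (\<forall>\<alpha>\<in>Field omega1. \<exists>\<beta>\<in>C. \<alpha> \<in> underS omega1 \<beta>) \<and>
    (\<forall>\<alpha>\<in>Field omega1.
      underS omega1 \<alpha> \<noteq> {} \<and>
      (\<forall>\<beta>\<in>underS omega1 \<alpha>. \<exists>\<gamma>\<in>C \<inter> underS omega1 \<alpha>. \<beta> \<in> underS omega1 \<gamma>) \<longrightarrow> \<alpha> \<in> C)"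

definition stationary_omega1 :: "nat set set \<Rightarrow> bool"
  where "stationary_omega1 S \<longleftrightarrow>
    S \<subseteq> Field omega1 \<and> (\<forall>C. club_omega1 C \<longrightarrow> S \<inter> C \<noteq> {})"

definition diamond :: bool
  where "diamond \<longleftrightarrow>
    (\<exists>A :: nat set \<Rightarrow> nat set set.
      (\<forall>\<alpha>\<in>Field omega1. A \<alpha> \<subseteq> underS omega1 \<alpha>) \<and>
      (\<forall>Z\<subseteq>Field omega1.
        stationary_omega1 {\<alpha>\<in>Field omega1. Z \<inter> underS omega1 \<alpha> = A \<alpha>}))"

end

theory Submission
  imports Defs "HOL-Library.Countable_Set_Type"
begin

text \<open>
  Call a closed set \<open>P \<subseteq> 2\<^sup>\<omega>\<close> fat if every node of its tree extends to a node at which, for some \<open>n\<close>,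
  all patterns on the block \<open>{n\<^sup>2..<(n + 1)\<^sup>2}\<close> of coordinates are allowed. Every \<open>z\<close> agrees with
  some point of \<open>P\<close> on infinitely many blocks, so \<open>P + G = 2\<^sup>\<omega>\<close> for the null set \<open>G\<close> of points
  vanishing on infinitely many blocks. By recursion on \<open>\<alpha> < \<omega>\<^sub>1\<close> one builds countable families
  \<open>L\<^sub>\<alpha>\<close> of fat sets, each consisting of fusions of sequences running through the earlier families,
  and points \<open>x\<^sub>\<alpha> \<in> \<Union>L\<^sub>\<alpha>\<close>; since \<open>\<Union>L\<^sub>\<alpha>\<close> decreases with \<open>\<alpha>\<close>, only the countably many
  \<open>x\<^sub>\<xi>\<close> with \<open>\<xi> < \<alpha>\<close> can lie outside it. If \<open>\<diamondsuit>\<close> guesses at \<open>\<alpha>\<close> the part \<open>V\<close> of \<open>Y\<close> built so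
  far together with an \<open>\<omega>\<close>-cover of \<open>Y\<close>, the fusion can pick members \<open>D\<^sub>n\<close> of the cover along the
  way: at a node whose cylinder meets \<open>Y\<close> one shrinks towards a point of \<open>V\<close> that \<open>D\<^sub>n\<close> contains.
  On a club of \<open>\<alpha>\<close> the sets of the earlier families that meet \<open>Y\<close> already meet \<open>V\<close>, and then
  all of \<open>Y\<close> is contained in \<open>\<Union>\<^sub>m \<Inter>\<^sub>n\<^sub>>\<^sub>m D\<^sub>n\<close>.
\<close>

section \<open>Cylinders and clopen sets\<close>

definition agree :: "nat \<Rightarrow> (nat \<Rightarrow> 'a) \<Rightarrow> (nat \<Rightarrow> 'a) \<Rightarrow> bool"
  where "agree k x y \<longleftrightarrow> (\<forall>i<k. x i = y i)"

lemma agree_refl [simp]: "agree k x x"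
  by (simp add: agree_def)

lemma agree_sym: "agree k x y \<Longrightarrow> agree k y x"
  by (simp add: agree_def)

lemma agree_trans: "agree k x y \<Longrightarrow> agree k y z \<Longrightarrow> agree k x z"
  by (simp add: agree_def)

lemma agree_mono: "agree m x y \<Longrightarrow> k \<le> m \<Longrightarrow> agree k x y"
  by (auto simp: agree_def)

text \<open>Strict growth of \<open>k\<close> gives \<open>i < k (Suc i)\<close>, so coordinate
  \<open>i\<close> is frozen from term \<open>Suc i\<close> on and can be read off there.\<close>

lemma agree_limit:
  fixes x :: "nat \<Rightarrow> nat \<Rightarrow> 'a" and k :: "nat \<Rightarrow> nat"
  assumes step: "\<And>m. agree (k m) (x m) (x (Suc m))" and mono: "\<And>m. k m < k (Suc m)"
  obtains l where "\<And>m. agree (k m) (x m) l"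
proof
  have km: "m \<le> k m" for m
    using mono by (intro strict_mono_imp_increasing) (simp add: strict_mono_Suc_iff)
  have kk: "k m \<le> k n" if "m \<le> n" for m n
    using lift_Suc_mono_le[of k m n] mono that by (simp add: less_imp_le)
  have later: "agree (k m) (x m) (x (m + d))" for m d
  proof (induction d)
    case (Suc d)
    then show ?case
      using agree_mono[OF step[of "m + d"] kk[of m "m + d"]] agree_trans by fastforce
  qed simp
  show "agree (k m) (x m) (\<lambda>i. x (Suc i) i)" for m
    unfolding agree_def
  proof (intro allI impI)
    fix i assume i: "i < k m"
    show "x m i = x (Suc i) i"
    \<comment> \<open>Coordinate \<open>i\<close> is frozen from term \<open>m\<close> on and also
      from term \<open>Suc i\<close> on; the earlier of the two terms is compared with the
      later.\<close>
    proof (cases "m \<le> Suc i")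
      case True
      then show ?thesis
        using later[of m "Suc i - m"] i by (simp add: agree_def)
    next
      case False
      moreover have "i < k (Suc i)"
        using km[of "Suc i"] by simp
      ultimately show ?thesis
        using later[of "Suc i" "m - Suc i"] by (simp add: agree_def)
    qed
  qed
qed

text \<open>By compactness the sets decided by finitely many coordinates are exactly the clopen
  ones; one implication suffices as \<open>agree\<close> is symmetric.\<close>

definition clopens :: "(nat \<Rightarrow> bool) set set"
  where "clopens = {C. \<exists>k. \<forall>x y. agree k x y \<longrightarrow> x \<in> C \<longrightarrow> y \<in> C}"

lemma clopensE:
  assumes "C \<in> clopens"
  obtains k where "\<And>x y. agree k x y \<Longrightarrow> x \<in> C \<longleftrightarrow> y \<in> C"
  using assms unfolding clopens_def by (blast intro: agree_sym)

lemma clopensI: "(\<And>x y. agree k x y \<Longrightarrow> x \<in> C \<Longrightarrow> y \<in> C) \<Longrightarrow> C \<in> clopens"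
  unfolding clopens_def by blast

lemma cylinder_clopen: "{y. agree k x y} \<in> clopens"
  by (rule clopensI[of k]) (auto intro: agree_trans)

lemma UNIV_clopen: "UNIV \<in> clopens"
  by (rule clopensI) auto

lemma clopens_Int:
  assumes "C \<in> clopens" "D \<in> clopens"
  shows "C \<inter> D \<in> clopens"
proof -
  obtain k where k: "\<And>x y. agree k x y \<Longrightarrow> x \<in> C \<longleftrightarrow> y \<in> C"
    using clopensE[OF assms(1)] by blast
  obtain m where m: "\<And>x y. agree m x y \<Longrightarrow> x \<in> D \<longleftrightarrow> y \<in> D"
    using clopensE[OF assms(2)] by blast
  show ?thesis
  proof (rule clopensI[of "max k m"])
    fix x y assume a: "agree (max k m) x y" and x: "x \<in> C \<inter> D"
    have "agree k x y" "agree m x y"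
      using a by (auto simp: agree_def)
    then show "y \<in> C \<inter> D"
      using k m x by blast
  qed
qed

lemma clopens_Union:
  assumes "finite \<C>" "\<C> \<subseteq> clopens"
  shows "\<Union>\<C> \<in> clopens"
  using assms
proof (induction \<C>)
  case empty
  show ?case
    by (rule clopensI) auto
next
  case (insert C \<C>)
  then have mem: "C \<in> clopens" "\<Union>\<C> \<in> clopens"
    by simp_all
  obtain k where k: "\<And>x y. agree k x y \<Longrightarrow> x \<in> C \<longleftrightarrow> y \<in> C"
    using clopensE[OF mem(1)] by blast
  obtain m where m: "\<And>x y. agree m x y \<Longrightarrow> x \<in> \<Union>\<C> \<longleftrightarrow> y \<in> \<Union>\<C>"
    using clopensE[OF mem(2)] by blast
  show ?case
  proof (rule clopensI[of "max k m"])
    fix x y assume a: "agree (max k m) x y" and x: "x \<in> \<Union>(insert C \<C>)"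
    have "agree k x y" "agree m x y"
      using a by (auto simp: agree_def)
    then show "y \<in> \<Union>(insert C \<C>)"
      using k[of x y] m[of x y] x by (simp only: Union_insert Un_iff)
  qed
qed

lemma agree_iff_map: "agree k x y \<longleftrightarrow> map x [0..<k] = map y [0..<k]"
  by (auto simp: agree_def)

lemma finite_cylinders: "finite (range (\<lambda>x :: nat \<Rightarrow> bool. {y. agree k x y}))"
proof (rule finite_subset)
  show "finite ((\<lambda>s. {y. s = map y [0..<k]}) ` {s :: bool list. length s = k})"
    using finite_lists_length_eq[of "UNIV :: bool set" k] by simp
  show "range (\<lambda>x :: nat \<Rightarrow> bool. {y. agree k x y}) \<subseteq>
      (\<lambda>s. {y. s = map y [0..<k]}) ` {s :: bool list. length s = k}"
  proof (rule image_subsetI)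
    fix x :: "nat \<Rightarrow> bool"
    show "{y. agree k x y} \<in> (\<lambda>s. {y. s = map y [0..<k]}) ` {s :: bool list. length s = k}"
      by (rule image_eqI[of _ _ "map x [0..<k]"]) (simp_all only: agree_iff_map, simp)
  qed
qed

text \<open>A set decided by the first \<open>k\<close> coordinates is a finite union of cylinders
  of length \<open>k\<close>, and there are only countably many cylinders.\<close>

lemma countable_clopens: "countable clopens"
proof (rule countable_subset)
  define B where "B = (\<Union>k. range (\<lambda>x :: nat \<Rightarrow> bool. {y. agree k x y}))"
  have "countable (range (\<lambda>x :: nat \<Rightarrow> bool. {y. agree k x y}))" for k
    by (rule countable_finite[OF finite_cylinders])
  then have "countable B"
    unfolding B_def by (intro countable_UN) auto
  then show "countable (Union ` {\<C>. finite \<C> \<and> \<C> \<subseteq> B})"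
    by (intro countable_image countable_Collect_finite_subset)
  show "clopens \<subseteq> Union ` {\<C>. finite \<C> \<and> \<C> \<subseteq> B}"
  proof
    fix C assume "C \<in> clopens"
    then obtain k where k: "\<And>x y. agree k x y \<Longrightarrow> x \<in> C \<longleftrightarrow> y \<in> C"
      using clopensE by blast
    define \<C> where "\<C> = (\<lambda>x. {y. agree k x y}) ` C"
    have "finite \<C>"
      unfolding \<C>_def by (rule finite_subset[OF _ finite_cylinders[of k]]) auto
    moreover have "\<C> \<subseteq> B"
      by (auto simp: \<C>_def B_def)
    moreover have "C = \<Union>\<C>"
      using k by (auto simp: \<C>_def)
    ultimately show "C \<in> Union ` {\<C>. finite \<C> \<and> \<C> \<subseteq> B}"
      by blast
  qed
qed

lemma open_contains_cylinder:
  fixes x :: "nat \<Rightarrow> bool"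
  assumes "open U" "x \<in> U"
  obtains k where "{y. agree k x y} \<subseteq> U"
proof -
  obtain X where X: "x \<in> (\<Pi>\<^sub>E i\<in>UNIV. X i)" "finite {i. X i \<noteq> UNIV}" "(\<Pi>\<^sub>E i\<in>UNIV. X i) \<subseteq> U"
    using product_topology_open_contains_basis[of "\<lambda>i. euclidean" UNIV U x] assms
    by (auto simp: open_fun_def)
  obtain k where k: "\<forall>i\<in>{i. X i \<noteq> UNIV}. i < k"
    using X(2) finite_nat_set_iff_bounded by auto
  have "y \<in> U" if "agree k x y" for y
  proof -
    have "y i \<in> X i" for i
    proof (cases "X i = UNIV")
      case False
      then have "x i = y i"
        using k that by (simp add: agree_def)
      then show ?thesis
        using PiE_mem[OF X(1), of i] by simp
    qed simp
    then show ?thesis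
      using X(3) by auto
  qed
  then show ?thesis
    using that by blast
qed

text \<open>Finitely many points need only finitely many cylinders inside \<open>U\<close>. This
  trades open covers for clopen ones, which natural numbers can code.\<close>

lemma clopen_between:
  assumes "open U" "finite F" "F \<subseteq> U"
  obtains C :: "(nat \<Rightarrow> bool) set" where "C \<in> clopens" "F \<subseteq> C" "C \<subseteq> U"
proof -
  have "\<forall>x\<in>F. \<exists>k. {y. agree k x y} \<subseteq> U"
    using assms open_contains_cylinder by (metis subsetD)
  then obtain k where k: "\<And>x. x \<in> F \<Longrightarrow> {y. agree (k x) x y} \<subseteq> U"
    by metis
  show ?thesis
  proof
    show "(\<Union>x\<in>F. {y. agree (k x) x y}) \<in> clopens"
      using assms(2) by (intro clopens_Union) (auto intro: cylinder_clopen)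
  qed (use k in auto)
qed

section \<open>Fat sets\<close>

text \<open>The fusion order: the trees of \<open>Q\<close> and \<open>P\<close> have the same nodes
  up to level \<open>N\<close>.\<close>

definition same_stem :: "nat \<Rightarrow> (nat \<Rightarrow> 'a) set \<Rightarrow> (nat \<Rightarrow> 'a) set \<Rightarrow> bool"
  where "same_stem N Q P \<longleftrightarrow> Q \<subseteq> P \<and> (\<forall>x\<in>P. \<exists>y\<in>Q. agree N x y)"

lemma same_stem_refl: "same_stem N P P"
  by (auto simp: same_stem_def intro: agree_refl)

lemma same_stem_trans: "same_stem N R Q \<Longrightarrow> same_stem N Q P \<Longrightarrow> same_stem N R P"
  unfolding same_stem_def by (meson agree_trans subset_trans subsetD)

text \<open>Closedness in a product of discrete spaces, expressed through the tree of initial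
  segments.\<close>

definition seq_closed :: "(nat \<Rightarrow> 'a) set \<Rightarrow> bool"
  where "seq_closed P \<longleftrightarrow> (\<forall>x. (\<forall>k. \<exists>y\<in>P. agree k x y) \<longrightarrow> x \<in> P)"

lemma seq_closedD: "seq_closed P \<Longrightarrow> (\<And>k. \<exists>y\<in>P. agree k x y) \<Longrightarrow> x \<in> P"
  by (auto simp: seq_closed_def)

text \<open>The blocks \<open>{n\<^sup>2..<(n + 1)\<^sup>2}\<close> have length \<open>2 n + 1\<close>, which makes Borel--Cantelli applicable
  to the points vanishing on infinitely many of them.\<close>

definition splits :: "(nat \<Rightarrow> 'a) set \<Rightarrow> nat \<Rightarrow> (nat \<Rightarrow> 'a) \<Rightarrow> bool"
  where "splits P n y \<longleftrightarrow> (\<forall>w. agree (n * n) y w \<longrightarrow> (\<exists>z\<in>P. agree (Suc n * Suc n) w z))"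

text \<open>Since \<open>k \<le> n \<le> n * n\<close>, the splitting block lies wholly beyond the
  node given by the first \<open>k\<close> values of \<open>x\<close>.\<close>

definition fat :: "(nat \<Rightarrow> 'a) set \<Rightarrow> bool"
  where "fat P \<longleftrightarrow> P \<noteq> {} \<and> seq_closed P \<and>
    (\<forall>x\<in>P. \<forall>k. \<exists>n\<ge>k. \<exists>y\<in>P. agree k x y \<and> splits P n y)"

text \<open>Membership in \<open>C\<close> is decided by \<open>m\<close> coordinates, so a
  splitting node above a point of \<open>C\<close> and beyond level \<open>max k m\<close> has all
  its extensions in \<open>C\<close>.\<close>

lemma fat_Int_clopen:
  assumes "fat P" "C \<in> clopens" "P \<inter> C \<noteq> {}"
  shows "fat (P \<inter> C)"
proof -
  obtain m where m: "\<And>x y. agree m x y \<Longrightarrow> x \<in> C \<longleftrightarrow> y \<in> C"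
    using clopensE[OF assms(2)] by blast
  have "seq_closed (P \<inter> C)"
    using assms(1) m unfolding fat_def seq_closed_def by blast
  moreover have "\<exists>n\<ge>k. \<exists>y\<in>P \<inter> C. agree k x y \<and> splits (P \<inter> C) n y" if x: "x \<in> P \<inter> C" for x k
  proof -
    obtain n y where n: "n \<ge> max k m" and y: "y \<in> P" "agree (max k m) x y" "splits P n y"
      using assms(1) x unfolding fat_def by blast
    have nm: "m \<le> n * n" "n * n \<le> Suc n * Suc n"
      using order_trans[OF _ le_square, of m n] n by simp_all
    have yC: "y \<in> C"
      using m[of x y] y(2) x agree_mono by fastforce
    have "splits (P \<inter> C) n y"
      unfolding splits_def
    proof (intro allI impI)
      fix w assume w: "agree (n * n) y w"
      then obtain z where z: "z \<in> P" "agree (Suc n * Suc n) w z"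
        using y(3) unfolding splits_def by blast
      have "agree m y z"
        using agree_trans[OF w agree_mono[OF z(2) nm(2)]] nm(1) by (rule agree_mono)
      then show "\<exists>z\<in>P \<inter> C. agree (Suc n * Suc n) w z"
        using m[of y z] yC z by blast
    qed
    then show ?thesis
      using n y yC agree_mono[OF y(2), of k] by auto
  qed
  ultimately show ?thesis
    using assms(3) by (simp add: fat_def)
qed

lemma fat_UNIV: "fat UNIV"
  unfolding fat_def seq_closed_def splits_def by (auto intro: agree_refl)

lemma fat_clopen: "C \<in> clopens \<Longrightarrow> C \<noteq> {} \<Longrightarrow> fat C"
  using fat_Int_clopen[OF fat_UNIV, of C] by simp

text \<open>Go to a splitting node, follow \<open>z\<close> through its block, and repeat; the limit
  stays in \<open>P\<close> by closedness. The pairs record a point and the length of its frozen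
  part.\<close>

lemma fat_hits:
  fixes z :: "nat \<Rightarrow> 'a"
  assumes "fat P"
  obtains x where "x \<in> P" "\<exists>\<^sub>\<infinity>n. \<forall>i\<in>{n * n..<Suc n * Suc n}. x i = z i"
proof -
  define good where "good = (\<lambda>p :: (nat \<Rightarrow> 'a) \<times> nat. fst p \<in> P)"
  define nxt where "nxt = (\<lambda>p q :: (nat \<Rightarrow> 'a) \<times> nat. agree (snd p) (fst p) (fst q) \<and> snd p < snd q \<and>
    (\<exists>n\<ge>snd p. Suc n * Suc n \<le> snd q \<and> (\<forall>i\<in>{n * n..<Suc n * Suc n}. fst q i = z i)))"
  have step: "\<exists>q. good q \<and> nxt p q" if p0: "good p" for p
  proof -
    obtain x k where p: "p = (x, k)" "x \<in> P"
      using p0 by (cases p) (auto simp: good_def)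
    obtain n y where n: "n \<ge> k" and y: "y \<in> P" "agree k x y" "splits P n y"
      using assms p(2) unfolding fat_def by blast
    \<comment> \<open>\<open>w\<close> continues the splitting node by \<open>z\<close>, so a point
      of \<open>P\<close> agreeing with \<open>w\<close> up to the end of the block copies
      \<open>z\<close> there.\<close>
    define w where "w = (\<lambda>i. if i < n * n then y i else z i)"
    have "agree (n * n) y w"
      by (simp add: agree_def w_def)
    then obtain x' where x': "x' \<in> P" "agree (Suc n * Suc n) w x'"
      using y(3) unfolding splits_def by blast
    have k: "k \<le> n * n" "n * n < Suc n * Suc n"
      using order_trans[OF n le_square] by simp_all
    define b where "b = Suc n * Suc n"
    have "agree k w x'"
      using agree_mono[OF x'(2)] k by simp
    moreover have "agree k y w"
      using agree_mono[OF \<open>agree (n * n) y w\<close> k(1)] .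
    ultimately have "agree k x x'"
      using y(2) by (blast intro: agree_trans)
    moreover have "k < b" "\<forall>i\<in>{n * n..<b}. x' i = z i"
      using x'(2) k unfolding b_def[symmetric] by (auto simp: agree_def w_def)
    ultimately have "good (x', b) \<and> nxt p (x', b)"
      unfolding good_def nxt_def p fst_conv snd_conv b_def[symmetric]
      using x'(1) n b_def by blast
    then show ?thesis ..
  qed
  obtain x0 where "x0 \<in> P"
    using assms by (auto simp: fat_def)
  then have "\<exists>p. good p"
    by (auto simp: good_def)
  then obtain s where s: "\<And>m :: nat. good (s m)" "\<And>m. nxt (s m) (s (Suc m))"
    using dependent_nat_choice[of "\<lambda>_. good" "\<lambda>_. nxt"] step by blast
  obtain l where l: "\<And>m. agree (snd (s m)) (fst (s m)) l"
    using agree_limit[of "\<lambda>m. snd (s m)" "\<lambda>m. fst (s m)"] s(2) by (auto simp: nxt_def)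
  have sm: "m \<le> snd (s m)" for m
    using s(2) strict_mono_imp_increasing[of "\<lambda>m. snd (s m)"] by (simp add: strict_mono_Suc_iff nxt_def)
  show ?thesis
  proof
    have "\<exists>y\<in>P. agree k l y" for k
      using agree_mono[OF l sm, of k] s(1)[of k] by (auto simp: good_def intro: agree_sym)
    then show "l \<in> P"
      using assms by (auto simp: fat_def intro: seq_closedD)
    show "\<exists>\<^sub>\<infinity>n. \<forall>i\<in>{n * n..<Suc n * Suc n}. l i = z i"
      unfolding INFM_nat_le
    proof
      fix m
      obtain n where n: "n \<ge> snd (s m)" "Suc n * Suc n \<le> snd (s (Suc m))"
        "\<forall>i\<in>{n * n..<Suc n * Suc n}. fst (s (Suc m)) i = z i"
        using s(2)[of m] by (auto simp: nxt_def)
      have "\<forall>i\<in>{n * n..<Suc n * Suc n}. l i = z i"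
        using n(2,3) l[of "Suc m"] by (simp add: agree_def)
      then show "\<exists>n\<ge>m. \<forall>i\<in>{n * n..<Suc n * Suc n}. l i = z i"
        using n(1) sm[of m] by (meson order_trans)
    qed
  qed
qed

text \<open>From \<open>x\<close> in \<open>P m\<close> the stem conditions give points of the sets
  \<open>P (m + i)\<close> that converge; the sets decrease and are closed, so the limit lies in all
  of them.\<close>

lemma same_stem_Inter:
  assumes stem: "\<And>m. same_stem (N m) (P (Suc m)) (P m)" and mono: "\<And>m. N m < N (Suc m)"
    and closed: "\<And>m. seq_closed (P m)"
  shows "same_stem (N m) (\<Inter>i. P i) (P m)"
  unfolding same_stem_def
proof (intro conjI ballI)
  fix x assume x: "x \<in> P m"
  \<comment> \<open>The clause about index 0 is vacuous for successors; it fixes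
    \<open>s 0 = x\<close> in the dependent choice.\<close>
  have "\<exists>z. (z \<in> P (m + Suc i) \<and> (Suc i = 0 \<longrightarrow> z = x)) \<and> agree (N (m + i)) y z"
    if "y \<in> P (m + i) \<and> (i = 0 \<longrightarrow> y = x)" for y i
    using stem[of "m + i"] that by (auto simp: same_stem_def)
  then have "\<exists>s. \<forall>i. (s i \<in> P (m + i) \<and> (i = 0 \<longrightarrow> s i = x)) \<and> agree (N (m + i)) (s i) (s (Suc i))"
    by (intro dependent_nat_choice) (use x in auto)
  then obtain s where s: "\<And>i. s i \<in> P (m + i) \<and> (i = 0 \<longrightarrow> s i = x)"
    "\<And>i. agree (N (m + i)) (s i) (s (Suc i))"
    by blast
  obtain l where l: "\<And>i. agree (N (m + i)) (s i) l"
    using agree_limit[of "\<lambda>i. N (m + i)" s] s(2) mono by auto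
  have Ni: "i \<le> N (m + i)" for i
    using mono strict_mono_imp_increasing[of "\<lambda>i. N (m + i)"] by (simp add: strict_mono_Suc_iff)
  have anti: "P j \<subseteq> P i" if "i \<le> j" for i j
    using lift_Suc_antimono_le[of P i j] stem that by (simp add: same_stem_def)
  have "l \<in> P i" for i
  proof (rule seq_closedD[OF closed])
    fix k
    have "s (i + k) \<in> P i"
      using conjunct1[OF s(1)[of "i + k"]] anti[of i "m + (i + k)"] by auto
    moreover have "agree k l (s (i + k))"
      using l[of "i + k"] Ni[of "i + k"] by (auto intro: agree_sym agree_mono)
    ultimately show "\<exists>y\<in>P i. agree k l y"
      by blast
  qed
  then show "\<exists>y\<in>\<Inter>i. P i. agree (N m) x y"
    using l[of 0] s(1)[of 0] by auto
qed (rule INF_lower, simp)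

text \<open>\<open>M\<close> bounds the ends of the splitting blocks uniformly, so refinements with
  the same stem up to \<open>M\<close> keep these splittings.\<close>

definition splits_within :: "nat \<Rightarrow> nat \<Rightarrow> (nat \<Rightarrow> 'a) set \<Rightarrow> bool"
  where "splits_within N M P \<longleftrightarrow>
    (\<forall>x\<in>P. \<exists>n\<ge>N. Suc n * Suc n \<le> M \<and> (\<exists>y\<in>P. agree N x y \<and> splits P n y))"

text \<open>Only finitely many cylinders of length \<open>N\<close> occur, and one splitting block
  is chosen for each; here binary branching matters.\<close>

lemma fat_splits_within:
  fixes P :: "(nat \<Rightarrow> bool) set"
  assumes "fat P"
  obtains M where "N < M" "splits_within N M P"
proof -
  define \<C> where "\<C> = (\<lambda>x. {y. agree N x y}) ` P"
  have fin: "finite \<C>"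
    unfolding \<C>_def by (rule finite_subset[OF _ finite_cylinders[of N]]) auto
  have "\<forall>S\<in>\<C>. \<exists>n\<ge>N. \<exists>y\<in>P. y \<in> S \<and> splits P n y"
    using assms by (auto simp: \<C>_def fat_def)
  then obtain f where f: "\<forall>S\<in>\<C>. f S \<ge> N \<and> (\<exists>y\<in>P. y \<in> S \<and> splits P (f S) y)"
    by (auto simp: bchoice_iff)
  define M where "M = Suc N + (\<Sum>S\<in>\<C>. Suc (f S) * Suc (f S))"
  show ?thesis
  proof
    show "N < M"
      by (simp add: M_def)
    show "splits_within N M P"
      unfolding splits_within_def
    proof
      fix x assume x: "x \<in> P"
      define S where "S = {y. agree N x y}"
      have S: "S \<in> \<C>"
        using x by (auto simp: S_def \<C>_def)
      have "Suc (f S) * Suc (f S) \<le> M"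
        using member_le_sum[OF S, of "\<lambda>S. Suc (f S) * Suc (f S)"] fin unfolding M_def by linarith
      then show "\<exists>n\<ge>N. Suc n * Suc n \<le> M \<and> (\<exists>y\<in>P. agree N x y \<and> splits P n y)"
        using bspec[OF f S] unfolding S_def by blast
    qed
  qed
qed

text \<open>The blocks supplied by \<open>within\<close> for \<open>P (Suc k)\<close> end by
  \<open>N (Suc k)\<close>, and up to that level the intersection has the same nodes as
  \<open>P (Suc k)\<close>, so the splittings survive.\<close>

lemma fat_Inter:
  assumes fat: "\<And>m. fat (P m)" and stem: "\<And>m. same_stem (N m) (P (Suc m)) (P m)"
    and mono: "\<And>m. N m < N (Suc m)" and within: "\<And>m. splits_within (N m) (N (Suc m)) (P (Suc m))"
  shows "fat (\<Inter>m. P m)"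
proof -
  let ?Q = "\<Inter>m. P m"
  have closed: "seq_closed (P m)" for m
    using fat by (simp add: fat_def)
  have stemQ: "same_stem (N m) ?Q (P m)" for m
    using same_stem_Inter[of N P] stem mono closed by blast
  have km: "m \<le> N m" for m
    using mono by (intro strict_mono_imp_increasing) (simp add: strict_mono_Suc_iff)
  have "?Q \<noteq> {}"
    using stemQ[of 0] fat[of 0] unfolding fat_def same_stem_def by blast
  moreover have "seq_closed ?Q"
    unfolding seq_closed_def
  proof (intro allI impI INT_I)
    fix x m assume "\<forall>k. \<exists>y\<in>?Q. agree k x y"
    then show "x \<in> P m"
      by (intro seq_closedD[OF closed]) blast
  qed
  moreover have "\<exists>n\<ge>k. \<exists>y\<in>?Q. agree k x y \<and> splits ?Q n y" if x: "x \<in> ?Q" for x k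
  proof -
    obtain n y where n: "n \<ge> N k" "Suc n * Suc n \<le> N (Suc k)"
      and y: "y \<in> P (Suc k)" "agree (N k) x y" "splits (P (Suc k)) n y"
      using within[of k] x unfolding splits_within_def by blast
    obtain y' where y': "y' \<in> ?Q" "agree (N (Suc k)) y y'"
      using stemQ[of "Suc k"] y(1) unfolding same_stem_def by blast
    have "agree k x y" "agree k y y'"
      using agree_mono[OF y(2) km] agree_mono[OF y'(2), of k] km[of "Suc k"] by simp_all
    moreover have "splits ?Q n y'"
      unfolding splits_def
    proof (intro allI impI)
      fix w assume "agree (n * n) y' w"
      moreover have "agree (n * n) y y'"
        using agree_mono[OF y'(2), of "n * n"] n(2) by simp
      ultimately obtain z where z: "z \<in> P (Suc k)" "agree (Suc n * Suc n) w z"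
        using y(3) agree_trans unfolding splits_def by blast
      obtain z' where "z' \<in> ?Q" "agree (N (Suc k)) z z'"
        using stemQ[of "Suc k"] z(1) unfolding same_stem_def by blast
      then show "\<exists>z\<in>?Q. agree (Suc n * Suc n) w z"
        using agree_trans[OF z(2)] agree_mono n(2) by blast
    qed
    ultimately show ?thesis
      using y'(1) agree_trans order_trans[OF km n(1)] by blast
  qed
  ultimately show ?thesis
    by (simp add: fat_def)
qed

section \<open>Fusion\<close>

text \<open>Closure under clopen pieces allows a member to be cut node by node inside the family and
  lets reflection be tested on each piece.\<close>

definition rich :: "(nat \<Rightarrow> bool) set set \<Rightarrow> bool"
  where "rich \<F> \<longleftrightarrow> countable \<F> \<and> (\<forall>P\<in>\<F>. fat P \<and> (\<forall>C\<in>clopens. P \<inter> C \<noteq> {} \<longrightarrow> P \<inter> C \<in> \<F>))"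

definition lim_inf :: "(nat \<Rightarrow> 'a set) \<Rightarrow> 'a set"
  where "lim_inf D = {x. \<forall>\<^sub>F n in sequentially. x \<in> D n}"

text \<open>All that a fusion against the guess \<open>V\<close> uses about \<open>Y\<close>, which
  is still unknown at that stage.\<close>

definition reflects :: "'a set set \<Rightarrow> 'a set \<Rightarrow> 'a set \<Rightarrow> bool"
  where "reflects \<F> V Y \<longleftrightarrow> (\<forall>P\<in>\<F>. P \<inter> Y \<noteq> {} \<longrightarrow> P \<inter> V \<noteq> {})"

text \<open>\<open>E\<close> has one point of \<open>P \<inter> V\<close> in each cylinder of length \<open>N\<close> that has such a point. In these
  cylinders \<open>P\<close> is cut down to \<open>U\<close>; the other ones carry no points of \<open>Y\<close>.\<close>

lemma shrink_into_clopen: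
  assumes "rich \<F>" "P \<in> \<F>"
  obtains E where "finite E" "E \<subseteq> V"
    and "\<And>U. U \<in> clopens \<Longrightarrow> E \<subseteq> U \<Longrightarrow>
      \<exists>Q\<in>\<F>. same_stem N Q P \<and> (\<forall>Y. reflects \<F> V Y \<longrightarrow> Q \<inter> Y \<subseteq> U)"
proof
  define pt where "pt = (\<lambda>S. SOME y. y \<in> P \<inter> S \<inter> V)"
  define \<C> where "\<C> = {S \<in> range (\<lambda>x. {y. agree N x y}). P \<inter> S \<inter> V \<noteq> {}}"
  have pt: "pt S \<in> P \<inter> S \<inter> V" if "S \<in> \<C>" for S
    unfolding pt_def some_in_eq using that by (simp add: \<C>_def)
  show "finite (pt ` \<C>)"
    using finite_cylinders[of N] by (simp add: \<C>_def)
  show "pt ` \<C> \<subseteq> V"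
    using pt by blast
  fix U assume U: "U \<in> clopens" "pt ` \<C> \<subseteq> U"
  define C where "C = {x. P \<inter> {y. agree N x y} \<inter> V = {} \<or> x \<in> U}"
  have "C \<in> clopens"
  proof -
    obtain m where m: "\<And>x y. agree m x y \<Longrightarrow> x \<in> U \<longleftrightarrow> y \<in> U"
      using clopensE[OF U(1)] by blast
    show ?thesis
    proof (rule clopensI[of "max N m"])
      fix x y assume a: "agree (max N m) x y" and x: "x \<in> C"
      have "agree N x y" and m': "agree m x y"
        using a by (auto simp: agree_def)
      then have "{z. agree N x z} = {z. agree N y z}"
        by (auto simp: agree_def)
      then show "y \<in> C"
        using x m[OF m'] by (simp add: C_def)
    qed
  qed
  \<comment> \<open>No node of level \<open>N\<close> is lost: if \<open>x\<close> is cut away, its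
    cylinder contains a chosen point of \<open>V\<close>, and that point lies in
    \<open>U\<close>.\<close>
  have hit: "\<exists>y\<in>P \<inter> C. agree N x y" if x: "x \<in> P" for x
  proof (cases "x \<in> C")
    case False
    then have "{y. agree N x y} \<in> \<C>"
      by (auto simp: C_def \<C>_def)
    then have "pt {y. agree N x y} \<in> P \<inter> {y. agree N x y}" "pt {y. agree N x y} \<in> U"
      using pt U(2) by blast+
    then show ?thesis
      by (intro bexI[of _ "pt {y. agree N x y}"]) (auto simp: C_def)
  qed (use x in \<open>auto intro: agree_refl\<close>)
  have "P \<noteq> {}"
    using assms by (auto simp: rich_def fat_def)
  then have "P \<inter> C \<in> \<F>"
    using hit assms \<open>C \<in> clopens\<close> unfolding rich_def by blast
  \<comment> \<open>Reflection is applied to the piece of \<open>P\<close> in the cylinder of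
    \<open>y\<close>: it contains a point of \<open>V\<close>, so \<open>y\<close> can be in
    \<open>C\<close> only by being in \<open>U\<close>.\<close>
  moreover have "P \<inter> C \<inter> Y \<subseteq> U" if refl: "reflects \<F> V Y" for Y
  proof
    fix y assume y: "y \<in> P \<inter> C \<inter> Y"
    have y': "y \<in> P \<inter> {z. agree N y z}"
      using y by simp
    then have "P \<inter> {z. agree N y z} \<in> \<F>"
      using assms cylinder_clopen[of N y] unfolding rich_def by blast
    moreover have "P \<inter> {z. agree N y z} \<inter> Y \<noteq> {}"
      using y y' by auto
    ultimately have "P \<inter> {z. agree N y z} \<inter> V \<noteq> {}"
      using refl by (simp add: reflects_def)
    then show "y \<in> U"
      using y by (simp add: C_def)
  qed
  moreover have "same_stem N (P \<inter> C) P"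
    using hit by (auto simp: same_stem_def)
  ultimately show "\<exists>Q\<in>\<F>. same_stem N Q P \<and> (\<forall>Y. reflects \<F> V Y \<longrightarrow> Q \<inter> Y \<subseteq> U)"
    by blast
qed

text \<open>\<open>E\<close> is fixed before \<open>U\<close>, so that one cover member can later
  serve several fusion sequences at once. After shrinking into \<open>U\<close>, density leads into
  \<open>\<D> i\<close>, and \<open>fat_splits_within\<close> supplies \<open>M\<close>.\<close>

lemma fusion_step:
  assumes "rich \<F>" "P \<in> \<F>"
    and sub: "\<And>i :: nat. \<D> i \<subseteq> \<F>"
    and dense: "\<And>i P N. P \<in> \<F> \<Longrightarrow> \<exists>Q\<in>\<D> i. same_stem N Q P"
  shows "\<exists>E. finite E \<and> E \<subseteq> V \<and> (\<forall>U i. U \<in> clopens \<longrightarrow> E \<subseteq> U \<longrightarrow>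
    (\<exists>Q M. Q \<in> \<D> i \<and> same_stem N Q P \<and> N < M \<and> splits_within N M Q \<and>
      (\<forall>Y. reflects \<F> V Y \<longrightarrow> Q \<inter> Y \<subseteq> U)))"
proof -
  obtain E where E: "finite E" "E \<subseteq> V" and shrink: "\<And>U. U \<in> clopens \<Longrightarrow> E \<subseteq> U \<Longrightarrow>
      \<exists>Q\<in>\<F>. same_stem N Q P \<and> (\<forall>Y. reflects \<F> V Y \<longrightarrow> Q \<inter> Y \<subseteq> U)"
    using shrink_into_clopen[OF assms(1,2), of V N] by blast
  have step: "\<exists>Q M. Q \<in> \<D> i \<and> same_stem N Q P \<and> N < M \<and> splits_within N M Q \<and>
      (\<forall>Y. reflects \<F> V Y \<longrightarrow> Q \<inter> Y \<subseteq> U)" if U: "U \<in> clopens" "E \<subseteq> U" for U i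
  proof -
    obtain R where R: "R \<in> \<F>" "same_stem N R P" "\<forall>Y. reflects \<F> V Y \<longrightarrow> R \<inter> Y \<subseteq> U"
      using shrink[OF U] by blast
    obtain Q where Q: "Q \<in> \<D> i" "same_stem N Q R"
      using dense[OF R(1)] by blast
    have "fat Q"
      using Q(1) sub assms(1) by (auto simp: rich_def)
    then obtain M where "N < M" "splits_within N M Q"
      by (rule fat_splits_within)
    moreover have "Q \<subseteq> R"
      using Q(2) by (simp add: same_stem_def)
    ultimately show ?thesis
      using Q R same_stem_trans[OF Q(2) R(2)] by blast
  qed
  show ?thesis
    by (rule exI[of _ E]) (intro conjI allI impI E step)
qed

text \<open>Each pair of a set and a level starts its own fusion sequence. At stage \<open>i\<close>
  all sequences \<open>j \<le> i\<close> make one step into a common cover member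
  \<open>D i\<close>, chosen to contain their finite sets \<open>E\<close> and an initial part of
  \<open>V\<close>; sequence \<open>j\<close> enters \<open>\<D> 0\<close>, \<open>\<D> 1\<close>
  and so on in turn.\<close>

lemma fusion:
  assumes rich: "rich \<F>" and ne: "\<F> \<noteq> {}"
    and sub: "\<And>i :: nat. \<D> i \<subseteq> \<F>"
    and dense: "\<And>i P N. P \<in> \<F> \<Longrightarrow> \<exists>Q\<in>\<D> i. same_stem N Q P"
    and V: "countable V" and clop: "\<J> \<subseteq> clopens"
    and cover: "\<And>F. finite F \<Longrightarrow> F \<subseteq> V \<Longrightarrow> \<exists>C\<in>\<J>. F \<subseteq> C"
  obtains D \<L> where "range D \<subseteq> \<J>" "V \<subseteq> lim_inf D" "rich \<L>"
    and "\<And>P N. P \<in> \<F> \<Longrightarrow> \<exists>Q\<in>\<L>. same_stem N Q P"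
    and "\<And>Q i. Q \<in> \<L> \<Longrightarrow> \<exists>P\<in>\<D> i. Q \<subseteq> P"
    and "\<And>Q Y. Q \<in> \<L> \<Longrightarrow> reflects \<F> V Y \<Longrightarrow> Q \<inter> Y \<subseteq> lim_inf D"
proof -
  define next_ok where "next_ok = (\<lambda>(P, N) U i (Q, M). Q \<in> \<D> i \<and> same_stem N Q P \<and> N < M \<and>
    splits_within N M Q \<and> (\<forall>Y. reflects \<F> V Y \<longrightarrow> Q \<inter> Y \<subseteq> U))"
  have "\<forall>p\<in>\<F> \<times> UNIV. \<exists>E. finite E \<and> E \<subseteq> V \<and> (\<forall>U i. U \<in> clopens \<longrightarrow> E \<subseteq> U \<longrightarrow> (\<exists>q. next_ok p U i q))"
    using fusion_step[where \<D> = \<D>, OF rich _ sub dense] unfolding next_ok_def by (auto simp: split_paired_Ex)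
  from bchoice[OF this] obtain E where
    *: "\<forall>p\<in>\<F> \<times> UNIV. finite (E p) \<and> E p \<subseteq> V \<and> (\<forall>U i. U \<in> clopens \<longrightarrow> E p \<subseteq> U \<longrightarrow> (\<exists>q. next_ok p U i q))"
    by blast
  have E: "finite (E p) \<and> E p \<subseteq> V" if "p \<in> \<F> \<times> UNIV" for p
    using bspec[OF * that] by simp
  have E_next: "\<exists>q. next_ok p U i q" if "p \<in> \<F> \<times> UNIV" "U \<in> clopens" "E p \<subseteq> U" for p U i
    using bspec[OF * that(1)] that(2,3) by simp
  define nxt where "nxt = (\<lambda>p U i. SOME q. next_ok p U i q)"
  have nxt: "next_ok p U i (nxt p U i)" if "\<exists>q. next_ok p U i q" for p U i
    unfolding nxt_def by (rule someI_ex[OF that])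
  define pick where "pick = (\<lambda>F. SOME C. C \<in> \<J> \<and> F \<subseteq> C)"
  \<comment> \<open>The intersection with \<open>V\<close> discards the arbitrary value of
    \<open>from_nat_into\<close> when \<open>V\<close> is empty.\<close>
  define F where "F = (\<lambda>i s. V \<inter> from_nat_into V ` {..i} \<union> (\<Union>j\<in>{..i :: nat}. E (s j)))"
  define task where "task = from_nat_into (\<F> \<times> (UNIV :: nat set))"
  \<comment> \<open>\<open>st i j\<close> is the position of sequence \<open>j\<close> before stage
    \<open>i\<close>; it rests at \<open>task j\<close> until stage \<open>j\<close>, and
    \<open>i - j\<close> counts its own steps.\<close>
  define st where "st = rec_nat task (\<lambda>i s j. if j \<le> i then nxt (s j) (pick (F i s)) (i - j) else s j)"
  define D where "D = (\<lambda>i. pick (F i (st i)))"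
  have st_0: "st 0 = task"
    and st_Suc: "st (Suc i) j = (if j \<le> i then nxt (st i j) (D i) (i - j) else st i j)" for i j
    by (simp_all add: st_def D_def)
  have range_task: "range task = \<F> \<times> UNIV"
    unfolding task_def using rich ne by (intro range_from_nat_into) (auto simp: rich_def)
  have pick: "pick A \<in> \<J> \<and> A \<subseteq> pick A" if "finite A" "A \<subseteq> V" for A
    unfolding pick_def by (rule someI_ex) (use cover[OF that] in blast)
  have D: "D i \<in> \<J> \<and> F i (st i) \<subseteq> D i" if "\<And>j. st i j \<in> \<F> \<times> UNIV" for i
    unfolding D_def by (rule pick) (use E[OF that] in \<open>auto simp: F_def\<close>)
  have next_st: "next_ok (st i j) (D i) (i - j) (st (Suc i) j)"
    if st: "\<And>j. st i j \<in> \<F> \<times> UNIV" and j: "j \<le> i" for i j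
  proof -
    have "E (st i j) \<subseteq> D i"
      using D[OF st] j by (auto simp: F_def)
    moreover have "D i \<in> clopens"
      using D[OF st] clop by blast
    ultimately have "next_ok (st i j) (D i) (i - j) (nxt (st i j) (D i) (i - j))"
      by (intro nxt E_next[OF st])
    then show ?thesis
      using j by (simp add: st_Suc)
  qed
  have st: "st i j \<in> \<F> \<times> UNIV" for i j
  proof (induction i arbitrary: j)
    case 0
    then show ?case
      using range_task by (auto simp: st_0)
  next
    case (Suc i)
    show ?case
    proof (cases "j \<le> i")
      case True
      then show ?thesis
        using next_st[OF Suc True] sub by (auto simp: next_ok_def split: prod.splits)
    next
      case False
      then show ?thesis
        using Suc by (simp add: st_Suc)
    qed
  qed
  have st_task: "st i j = task j" if "i \<le> j" for i j
    using that by (induction i) (auto simp: st_0 st_Suc)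
  define P where "P = (\<lambda>j m. fst (st (j + m) j))"
  define N where "N = (\<lambda>j m. snd (st (j + m) j))"
  have PN: "P j (Suc m) \<in> \<D> m" "same_stem (N j m) (P j (Suc m)) (P j m)" "N j m < N j (Suc m)"
    "splits_within (N j m) (N j (Suc m)) (P j (Suc m))"
    "\<And>Y. reflects \<F> V Y \<Longrightarrow> P j (Suc m) \<inter> Y \<subseteq> D (j + m)" for j m
    using next_st[of "j + m" j] st by (auto simp: next_ok_def P_def N_def split: prod.splits)
  have fatP: "fat (P j m)" for j m
    using st[of "j + m" j] rich by (auto simp: P_def rich_def)
  define Q where "Q = (\<lambda>j. \<Inter>m. P j m)"
  have fatQ: "fat (Q j)" for j
    unfolding Q_def using fat_Inter[of "P j" "N j"] fatP PN by blast
  have stemQ: "same_stem (N j 0) (Q j) (P j 0)" for j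
    unfolding Q_def using same_stem_Inter[of "N j" "P j" 0] fatP PN by (simp add: fat_def)
  \<comment> \<open>Clopen pieces of the limits are included to make the new family rich
    again.\<close>
  define \<L> where "\<L> = {Q j \<inter> C | j C. C \<in> clopens \<and> Q j \<inter> C \<noteq> {}}"
  show ?thesis
  proof (rule that[of D \<L>])
    show "range D \<subseteq> \<J>"
      using D st by blast
    show "V \<subseteq> lim_inf D"
    proof
      fix v assume v: "v \<in> V"
      then obtain k where k: "from_nat_into V k = v"
        using from_nat_into_surj[OF V] by blast
      have "v \<in> D i" if "k \<le> i" for i
        using D[OF st, of i] v k that by (auto simp: F_def)
      then show "v \<in> lim_inf D"
        by (auto simp: lim_inf_def eventually_sequentially)
    qed
    show "rich \<L>"
      unfolding rich_def
    proof (intro conjI ballI impI)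
      have "\<L> \<subseteq> (\<lambda>(j, C). Q j \<inter> C) ` (UNIV \<times> clopens)"
        by (auto simp: \<L>_def)
      then show "countable \<L>"
        by (rule countable_subset) (intro countable_image countable_SIGMA countable_clopens, simp)
      fix R assume "R \<in> \<L>"
      then obtain j C where R: "R = Q j \<inter> C" "C \<in> clopens" "Q j \<inter> C \<noteq> {}"
        by (auto simp: \<L>_def)
      show "fat R"
        using fat_Int_clopen[OF fatQ] R by simp
      fix B assume "B \<in> clopens" "R \<inter> B \<noteq> {}"
      then show "R \<inter> B \<in> \<L>"
        unfolding \<L>_def R(1) using clopens_Int[OF R(2)] by (auto simp: Int_assoc)
    qed
    show "\<exists>R\<in>\<L>. same_stem n R S" if "S \<in> \<F>" for S n
    proof -
      have "(S, n) \<in> range task"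
        using that range_task by simp
      then obtain j where j: "task j = (S, n)"
        by (metis rangeE)
      have "Q j \<in> \<L>"
        unfolding \<L>_def using UNIV_clopen fatQ[of j] by (force simp: fat_def)
      moreover have "same_stem n (Q j) S"
        using stemQ[of j] st_task[of j j] j by (simp add: N_def P_def)
      ultimately show ?thesis
        by blast
    qed
    show "\<exists>S\<in>\<D> i. R \<subseteq> S" if R: "R \<in> \<L>" for R i
    proof -
      obtain j where "R \<subseteq> Q j"
        using R by (auto simp: \<L>_def)
      then show ?thesis
        using PN(1)[of j i] by (intro bexI[of _ "P j (Suc i)"]) (auto simp: Q_def)
    qed
    show "R \<inter> Y \<subseteq> lim_inf D" if R: "R \<in> \<L>" and Y: "reflects \<F> V Y" for R Y
    proof
      fix y assume y: "y \<in> R \<inter> Y"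
      obtain j where "R \<subseteq> Q j"
        using R by (auto simp: \<L>_def)
      then have "y \<in> D (j + m)" for m
        using PN(5)[OF Y, of j m] y by (auto simp: Q_def)
      then have "y \<in> D i" if "j \<le> i" for i
        using that by (metis le_add_diff_inverse)
      then show "y \<in> lim_inf D"
        by (auto simp: lim_inf_def eventually_sequentially)
    qed
  qed
qed

section \<open>The ordinal \<open>\<omega>\<^sub>1\<close>\<close>

lemma Card_order_omega1: "Card_order omega1"
  by (rule cardSuc_Card_order[OF natLeq_Card_order])

lemma Well_order_omega1: "Well_order omega1"
  using Card_order_omega1 by (simp add: card_order_on_def)

lemma underS_omega1_Field: "\<beta> \<in> underS omega1 \<alpha> \<Longrightarrow> \<beta> \<in> Field omega1"
  by (auto simp: underS_def Field_def)

lemma underS_omega1_irrefl: "\<alpha> \<notin> underS omega1 \<alpha>"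
  by (simp add: underS_def)

lemma underS_omega1_trans:
  assumes "\<alpha> \<in> underS omega1 \<beta>" "\<beta> \<in> underS omega1 \<gamma>"
  shows "\<alpha> \<in> underS omega1 \<gamma>"
proof -
  have "trans omega1" "antisym omega1"
    using Well_order_omega1 by (simp_all add: order_on_defs)
  then show ?thesis
    using assms unfolding underS_def by (auto dest: transD antisymD)
qed

lemma underS_omega1_total:
  assumes "\<alpha> \<in> Field omega1" "\<beta> \<in> Field omega1"
  shows "\<alpha> = \<beta> \<or> \<alpha> \<in> underS omega1 \<beta> \<or> \<beta> \<in> underS omega1 \<alpha>"
  using Well_order_omega1 assms unfolding underS_def order_on_defs total_on_def by blast

lemma wf_underS_omega1: "wf {(\<beta>, \<alpha>). \<beta> \<in> underS omega1 \<alpha>}"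
proof -
  have "wf (omega1 - Id)"
    using Well_order_omega1 by (simp add: well_order_on_def)
  moreover have "{(\<beta>, \<alpha>). \<beta> \<in> underS omega1 \<alpha>} = omega1 - Id"
    by (auto simp: underS_def)
  ultimately show ?thesis
    by simp
qed

lemma countable_underS_omega1:
  includes cardinal_syntax
  shows "countable (underS omega1 \<alpha>)"
proof (cases "\<alpha> \<in> Field omega1")
  case True
  then have "|underS omega1 \<alpha>| <o omega1"
    by (rule card_of_underS[OF Card_order_omega1])
  then show ?thesis
    by (simp add: cardSuc_ordLeq_ordLess natLeq_Card_order countable_card_le_natLeq card_of_Card_order)
next
  case False
  then have "underS omega1 \<alpha> = {}"
    by (auto simp: underS_def Field_def)
  then show ?thesis
    by simp
qed

lemma uncountable_omega1:
  includes cardinal_syntax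
  shows "uncountable (Field omega1)"
proof
  assume "countable (Field omega1)"
  then have "|Field omega1| \<le>o natLeq"
    by (simp add: countable_card_le_natLeq)
  moreover have "|Field omega1| =o omega1"
    by (rule card_of_Field_ordIso[OF Card_order_omega1])
  ultimately have "omega1 \<le>o natLeq"
    using ordIso_symmetric ordIso_ordLeq_trans by blast
  then show False
    using cardSuc_greater[OF natLeq_Card_order] not_ordLess_ordLeq by blast
qed

text \<open>\<open>K\<close> together with all predecessors of its elements is still countable; any
  ordinal outside it lies above \<open>K\<close>.\<close>

lemma countable_bounded_omega1:
  assumes "countable K" "K \<subseteq> Field omega1"
  shows "\<exists>\<alpha>\<in>Field omega1. K \<subseteq> underS omega1 \<alpha>"
proof -
  have "countable (K \<union> (\<Union>\<beta>\<in>K. underS omega1 \<beta>))"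
    using assms(1) countable_underS_omega1 by auto
  then obtain \<alpha> where \<alpha>: "\<alpha> \<in> Field omega1" "\<alpha> \<notin> K \<union> (\<Union>\<beta>\<in>K. underS omega1 \<beta>)"
    using uncountable_omega1 by (metis countable_subset subsetI)
  have "K \<subseteq> underS omega1 \<alpha>"
    using \<alpha> assms(2) underS_omega1_total by blast
  then show ?thesis
    using \<alpha>(1) by blast
qed

text \<open>The usual closing-off: iterate \<omega> times a step above the current ordinal and above
  the \<open>g\<close>-images of everything below it, then take the supremum.\<close>

lemma club_closure_points:
  assumes g: "\<And>\<beta>. \<beta> \<in> Field omega1 \<Longrightarrow> g \<beta> \<in> Field omega1" and \<alpha>0: "\<alpha>0 \<in> Field omega1"
  shows "club_omega1 {\<alpha> \<in> Field omega1. \<alpha>0 \<in> underS omega1 \<alpha> \<and>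
    (\<forall>\<beta>\<in>underS omega1 \<alpha>. g \<beta> \<in> underS omega1 \<alpha>)}" (is "club_omega1 ?C")
  unfolding club_omega1_def
proof (intro conjI ballI impI)
  show "?C \<subseteq> Field omega1"
    by blast
next
  fix \<alpha> assume \<alpha>: "\<alpha> \<in> Field omega1"
  have "\<exists>b. b \<in> Field omega1 \<and> insert a (g ` underS omega1 a) \<subseteq> underS omega1 b" if "a \<in> Field omega1" for a
  proof -
    have "insert a (g ` underS omega1 a) \<subseteq> Field omega1"
      using that g underS_omega1_Field by blast
    moreover have "countable (insert a (g ` underS omega1 a))"
      using countable_underS_omega1 by simp
    ultimately show ?thesis
      using countable_bounded_omega1 by blast
  qed
  then obtain b where b: "\<And>a. a \<in> Field omega1 \<Longrightarrow> b a \<in> Field omega1"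
    "\<And>a. a \<in> Field omega1 \<Longrightarrow> insert a (g ` underS omega1 a) \<subseteq> underS omega1 (b a)"
    by metis
  obtain s0 where s0: "s0 \<in> Field omega1" "{\<alpha>, \<alpha>0} \<subseteq> underS omega1 s0"
    using countable_bounded_omega1[of "{\<alpha>, \<alpha>0}"] \<alpha> \<alpha>0 by auto
  define s where "s = (\<lambda>n. (b ^^ n) s0)"
  have s: "s n \<in> Field omega1" for n
    by (induction n) (auto simp: s_def s0 b)
  have s_Suc: "insert (s n) (g ` underS omega1 (s n)) \<subseteq> underS omega1 (s (Suc n))" for n
    using b(2)[OF s, of n] by (simp add: s_def)
  obtain u where u: "u \<in> Field omega1" "range s \<subseteq> underS omega1 u"
    using countable_bounded_omega1[of "range s"] s by auto
  \<comment> \<open>\<beta> is the supremum of the \<open>s n\<close>: by minimality each \<gamma>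
    below \<beta> is at most some \<open>s n\<close>, hence below \<open>s (Suc n)\<close>.\<close>
  obtain \<beta> where \<beta>: "range s \<subseteq> underS omega1 \<beta>"
    and least: "\<And>\<gamma>. \<gamma> \<in> underS omega1 \<beta> \<Longrightarrow> \<not> range s \<subseteq> underS omega1 \<gamma>"
    using wfE_min[OF wf_underS_omega1, of u "{\<gamma>. range s \<subseteq> underS omega1 \<gamma>}"] u(2) by auto
  have \<beta>F: "\<beta> \<in> Field omega1"
    using \<beta> by (auto simp: underS_def Field_def)
  have s0\<beta>: "s0 \<in> underS omega1 \<beta>"
    using subsetD[OF \<beta> rangeI[of s 0]] by (simp add: s_def)
  have "g \<gamma> \<in> underS omega1 \<beta>" if \<gamma>: "\<gamma> \<in> underS omega1 \<beta>" for \<gamma>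
  proof -
    obtain n where "s n \<notin> underS omega1 \<gamma>"
      using least[OF \<gamma>] by auto
    then have "\<gamma> = s n \<or> \<gamma> \<in> underS omega1 (s n)"
      using underS_omega1_total[OF s underS_omega1_Field[OF \<gamma>]] by auto
    then have "\<gamma> \<in> underS omega1 (s (Suc n))"
      using s_Suc[of n] underS_omega1_trans by blast
    then have "g \<gamma> \<in> underS omega1 (s (Suc (Suc n)))"
      using s_Suc[of "Suc n"] by blast
    then show ?thesis
      using \<beta> underS_omega1_trans by blast
  qed
  then have "\<beta> \<in> ?C"
    using \<beta>F s0(2) s0\<beta> underS_omega1_trans by blast
  moreover have "\<alpha> \<in> underS omega1 \<beta>"
    using s0(2) s0\<beta> underS_omega1_trans by blast
  ultimately show "\<exists>\<beta>\<in>?C. \<alpha> \<in> underS omega1 \<beta>"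
    by blast
next
  fix \<alpha> assume \<alpha>: "\<alpha> \<in> Field omega1" and lim: "underS omega1 \<alpha> \<noteq> {} \<and>
    (\<forall>\<beta>\<in>underS omega1 \<alpha>. \<exists>\<gamma>\<in>?C \<inter> underS omega1 \<alpha>. \<beta> \<in> underS omega1 \<gamma>)"
  have "\<alpha>0 \<in> underS omega1 \<alpha>"
    using lim underS_omega1_trans by blast
  moreover have "g \<beta> \<in> underS omega1 \<alpha>" if "\<beta> \<in> underS omega1 \<alpha>" for \<beta>
    using lim that underS_omega1_trans by blast
  ultimately show "\<alpha> \<in> ?C"
    using \<alpha> by blast
qed

section \<open>The null set\<close>

definition vanishing :: "(nat \<Rightarrow> bool) set"
  where "vanishing = {g. \<exists>\<^sub>\<infinity>n. \<forall>i\<in>{n * n..<Suc n * Suc n}. \<not> g i}"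

text \<open>Vanishing on block \<open>n\<close> has probability \<open>(1/2) ^ (2 * n + 1)\<close>,
  which is summable, so Borel-Cantelli applies.\<close>

lemma cantor_null_vanishing: "cantor_null vanishing"
proof -
  interpret product_prob_space "\<lambda>_ :: nat. measure_pmf (bernoulli_pmf (1/2))" UNIV
    by unfold_locales
  define I where "I = (\<lambda>n :: nat. {n * n..<Suc n * Suc n})"
  define A where "A = (\<lambda>n. {g :: nat \<Rightarrow> bool. \<forall>i\<in>I n. \<not> g i})"
  have A_emb: "A n = prod_emb UNIV (\<lambda>_. measure_pmf (bernoulli_pmf (1/2))) (I n) (\<Pi>\<^sub>E i\<in>I n. {False})" for n
    unfolding A_def prod_emb_def vimage_def restrict_PiE_iff by simp
  have A_sets: "A n \<in> sets cantor_measure" for n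
    unfolding A_emb cantor_measure_def by (intro sets_PiM_I) (auto simp: I_def)
  have A_measure: "measure cantor_measure (A n) = (1/2) ^ Suc (n + n)" for n
  proof -
    have "measure cantor_measure (A n) = (\<Prod>i\<in>I n. measure (measure_pmf (bernoulli_pmf (1/2))) {False})"
      unfolding A_emb cantor_measure_def by (rule measure_PiM_emb) (auto simp: I_def)
    also have "\<dots> = (1/2) ^ card (I n)"
      by (simp add: measure_pmf_single)
    finally show ?thesis
      by (simp add: I_def)
  qed
  have "summable (\<lambda>n. measure cantor_measure (A n))"
  proof (rule summable_comparison_test'[of "\<lambda>n. (1/2 :: real) ^ n" 0])
    show "norm (measure cantor_measure (A n)) \<le> (1/2) ^ n" for n
      using power_decreasing[of n "Suc (n + n)" "1/2 :: real"] by (simp add: A_measure del: power_Suc)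
  qed (simp add: summable_geometric)
  moreover have "emeasure cantor_measure (A n) < \<infinity>" for n
    unfolding cantor_measure_def using P.emeasure_finite[of "A n"] by (simp add: less_top[symmetric])
  ultimately have "limsup A \<in> null_sets cantor_measure"
    using A_sets by (intro borel_cantelli_limsup1)
  moreover have "limsup A = vanishing"
    by (auto simp: limsup_INF_SUP vanishing_def INFM_nat_le A_def I_def)
  ultimately show ?thesis
    by (auto simp: cantor_null_def null_sets_completion_iff2)
qed

section \<open>The transfinite construction\<close>

text \<open>The nonempty clopen sets act as an initial family, so the construction can start at the
  least ordinal.\<close>

definition lower :: "(nat set \<Rightarrow> (nat \<Rightarrow> bool) set set) \<Rightarrow> nat set \<Rightarrow> (nat \<Rightarrow> bool) set set"
  where "lower L \<alpha> = (clopens - {{}}) \<union> (\<Union>\<beta>\<in>underS omega1 \<alpha>. L \<beta>)"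

text \<open>The second clause keeps every earlier set refinable at stage \<alpha>; the third makes
  the unions of the families decrease.\<close>

definition extends :: "(nat set \<Rightarrow> (nat \<Rightarrow> bool) set set) \<Rightarrow> nat set \<Rightarrow> (nat \<Rightarrow> bool) set set \<Rightarrow> bool"
  where "extends L \<alpha> \<M> \<longleftrightarrow> rich \<M> \<and>
    (\<forall>P\<in>lower L \<alpha>. \<forall>N. \<exists>Q\<in>\<M>. same_stem N Q P) \<and>
    (\<forall>\<beta>\<in>underS omega1 \<alpha>. \<forall>Q\<in>\<M>. \<exists>P\<in>L \<beta>. Q \<subseteq> P)"

text \<open>\<open>V\<close> is the guess for the part of \<open>Y\<close> constructed so far and \<open>\<J>\<close> the guess for its cover.\<close>

definition captures :: "(nat \<Rightarrow> bool) set set \<Rightarrow> (nat \<Rightarrow> bool) set \<Rightarrow> (nat \<Rightarrow> bool) set set \<Rightarrow>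
    (nat \<Rightarrow> bool) set set \<Rightarrow> bool"
  where "captures \<F> V \<J> \<M> \<longleftrightarrow>
    (\<forall>F. finite F \<longrightarrow> F \<subseteq> V \<longrightarrow> (\<exists>C\<in>\<J>. F \<subseteq> C)) \<longrightarrow>
    (\<exists>D. range D \<subseteq> \<J> \<and> V \<subseteq> lim_inf D \<and>
      (\<forall>Q\<in>\<M>. \<forall>Y. reflects \<F> V Y \<longrightarrow> Q \<inter> Y \<subseteq> lim_inf D))"

section \<open>One stage of the recursion, and the recursion itself\<close>

lemma lower_cong: "(\<And>\<beta>. \<beta> \<in> underS omega1 \<alpha> \<Longrightarrow> L \<beta> = L' \<beta>) \<Longrightarrow> lower L \<alpha> = lower L' \<alpha>"
  by (simp add: lower_def)

lemma extends_cong: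
  "(\<And>\<beta>. \<beta> \<in> underS omega1 \<alpha> \<Longrightarrow> L \<beta> = L' \<beta>) \<Longrightarrow> extends L \<alpha> \<M> = extends L' \<alpha> \<M>"
  using lower_cong[of \<alpha> L L'] by (simp add: extends_def)

lemma rich_lower:
  assumes "\<And>\<beta>. \<beta> \<in> underS omega1 \<alpha> \<Longrightarrow> rich (L \<beta>)"
  shows "rich (lower L \<alpha>)"
  unfolding rich_def
proof (intro conjI ballI impI)
  show "countable (lower L \<alpha>)"
    using assms countable_clopens countable_underS_omega1 by (auto simp: lower_def rich_def)
next
  fix P assume "P \<in> lower L \<alpha>"
  then show "fat P"
    using assms fat_clopen by (auto simp: lower_def rich_def)
next
  fix P C assume P: "P \<in> lower L \<alpha>" and C: "C \<in> clopens" "P \<inter> C \<noteq> {}"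
  show "P \<inter> C \<in> lower L \<alpha>"
  proof (cases "P \<in> clopens")
    case True
    then show ?thesis
      using clopens_Int C by (simp add: lower_def)
  next
    case False
    then obtain \<beta> where "\<beta> \<in> underS omega1 \<alpha>" "P \<in> L \<beta>"
      using P by (auto simp: lower_def)
    then have "P \<inter> C \<in> L \<beta>"
      using assms[of \<beta>] C by (simp add: rich_def)
    then show ?thesis
      using \<open>\<beta> \<in> underS omega1 \<alpha>\<close> by (auto simp: lower_def)
  qed
qed

text \<open>Fusion is run on \<open>lower L \<alpha>\<close>, with \<open>\<D> i\<close> demanding a
  superset in the earlier family numbered \<open>i\<close>; any member of the resulting family is
  fat and so provides \<open>x\<close>.\<close>

lemma stage_exists:
  fixes z :: "nat \<Rightarrow> bool"
  assumes below: "\<And>\<beta>. \<beta> \<in> underS omega1 \<alpha> \<Longrightarrow> extends L \<beta> (L \<beta>)"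
    and V: "countable V" and clop: "\<J> \<subseteq> clopens"
  shows "\<exists>\<M> x. extends L \<alpha> \<M> \<and> captures (lower L \<alpha>) V \<J> \<M> \<and> x \<in> \<Union>\<M> \<and>
    (\<exists>\<^sub>\<infinity>n. \<forall>i\<in>{n * n..<Suc n * Suc n}. x i = z i)"
proof -
  define \<F> where "\<F> = lower L \<alpha>"
  have rich: "rich \<F>"
    unfolding \<F>_def using below by (intro rich_lower) (simp add: extends_def)
  have UNIV: "UNIV \<in> \<F>"
    using UNIV_clopen by (simp add: \<F>_def lower_def)
  define u where "u = from_nat_into (underS omega1 \<alpha>)"
  \<comment> \<open>The guard on \<open>u i\<close> covers the case of no predecessors, where the
    enumeration takes an arbitrary value.\<close>
  define \<D> where "\<D> = (\<lambda>i. {Q \<in> \<F>. u i \<in> underS omega1 \<alpha> \<longrightarrow> (\<exists>P\<in>L (u i). Q \<subseteq> P)})"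
  have dense: "\<exists>Q\<in>\<D> i. same_stem N Q P" if P: "P \<in> \<F>" for i P N
  proof (cases "P \<in> \<D> i")
    case True
    then show ?thesis
      using same_stem_refl by blast
  next
    case False
    define \<gamma> where "\<gamma> = u i"
    have \<gamma>: "\<gamma> \<in> underS omega1 \<alpha>" and no: "\<not> (\<exists>R\<in>L \<gamma>. P \<subseteq> R)"
      using False P by (auto simp: \<D>_def \<gamma>_def)
    \<comment> \<open>Otherwise \<open>P\<close> comes from some \<open>L \<beta>\<close> with
      \<beta> equal to \<gamma> or above it, and then it already has a superset in
      \<open>L \<gamma>\<close>.\<close>
    have "P \<in> lower L \<gamma>"
    proof (rule ccontr)
      assume nP: "P \<notin> lower L \<gamma>"
      then obtain \<beta> where \<beta>: "\<beta> \<in> underS omega1 \<alpha>" "P \<in> L \<beta>" "\<beta> \<notin> underS omega1 \<gamma>"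
        using P by (auto simp: \<F>_def lower_def)
      then have "\<gamma> \<in> underS omega1 \<beta>"
        using no underS_omega1_total[of \<beta> \<gamma>] \<gamma> underS_omega1_Field by blast
      then show False
        using below[OF \<beta>(1)] \<beta>(2) no by (simp add: extends_def)
    qed
    then obtain Q where Q: "Q \<in> L \<gamma>" "same_stem N Q P"
      using below[OF \<gamma>] unfolding extends_def by blast
    have "Q \<in> \<F>"
      using Q(1) \<gamma> by (auto simp: \<F>_def lower_def)
    then have "Q \<in> \<D> i"
      using Q(1) by (auto simp: \<D>_def \<gamma>_def)
    then show ?thesis
      using Q(2) by blast
  qed
  define covered where "covered \<longleftrightarrow> (\<forall>F. finite F \<longrightarrow> F \<subseteq> V \<longrightarrow> (\<exists>C\<in>\<J>. F \<subseteq> C))"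
  \<comment> \<open>If the guess is not a cover of the required kind, \<open>captures\<close> is
    vacuous and the trivial cover keeps the fusion running.\<close>
  define \<J>' where "\<J>' = (if covered then \<J> else {UNIV})"
  have clop': "\<J>' \<subseteq> clopens"
    using clop UNIV_clopen by (simp add: \<J>'_def)
  have cover': "\<exists>C\<in>\<J>'. F \<subseteq> C" if "finite F" "F \<subseteq> V" for F
    using that by (simp add: \<J>'_def covered_def)
  have sub: "\<D> i \<subseteq> \<F>" for i
    by (auto simp: \<D>_def)
  have ne: "\<F> \<noteq> {}"
    using UNIV by blast
  obtain D \<M> where D: "range D \<subseteq> \<J>'" "V \<subseteq> lim_inf D" and \<M>: "rich \<M>"
    "\<And>P N. P \<in> \<F> \<Longrightarrow> \<exists>Q\<in>\<M>. same_stem N Q P"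
    "\<And>Q i. Q \<in> \<M> \<Longrightarrow> \<exists>P\<in>\<D> i. Q \<subseteq> P"
    "\<And>Q Y. Q \<in> \<M> \<Longrightarrow> reflects \<F> V Y \<Longrightarrow> Q \<inter> Y \<subseteq> lim_inf D"
    by (rule fusion[where \<D> = \<D>, OF rich ne sub dense V clop' cover']) (fact | blast)+
  have "\<exists>P\<in>L \<beta>. Q \<subseteq> P" if \<beta>: "\<beta> \<in> underS omega1 \<alpha>" and Q: "Q \<in> \<M>" for \<beta> Q
  proof -
    obtain i where i: "u i = \<beta>"
      using from_nat_into_surj[OF countable_underS_omega1 \<beta>] by (auto simp: u_def)
    obtain R where R: "R \<in> \<D> i" "Q \<subseteq> R"
      using \<M>(3)[OF Q] by blast
    then have "\<exists>P\<in>L \<beta>. R \<subseteq> P"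
      using \<beta> i by (simp add: \<D>_def)
    then show ?thesis
      using R(2) by blast
  qed
  then have "extends L \<alpha> \<M>"
    using \<M>(1,2) by (simp add: extends_def \<F>_def)
  moreover have "captures (lower L \<alpha>) V \<J> \<M>"
    unfolding captures_def covered_def[symmetric] \<F>_def[symmetric]
  proof
    assume covered
    then show "\<exists>D. range D \<subseteq> \<J> \<and> V \<subseteq> lim_inf D \<and>
        (\<forall>Q\<in>\<M>. \<forall>Y. reflects \<F> V Y \<longrightarrow> Q \<inter> Y \<subseteq> lim_inf D)"
      using D \<M>(4) by (intro exI[of _ D]) (simp add: \<J>'_def)
  qed
  moreover obtain Q where Q: "Q \<in> \<M>"
    using \<M>(2)[OF UNIV] by blast
  then have "fat Q"
    using \<M>(1) by (simp add: rich_def)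
  then obtain x where "x \<in> Q" "\<exists>\<^sub>\<infinity>n. \<forall>i\<in>{n * n..<Suc n * Suc n}. x i = z i"
    using fat_hits by blast
  ultimately show ?thesis
    using Q by blast
qed

text \<open>The injection \<open>e\<close> reserves countably many ordinals for coding a set of natural numbers into
  the guess \<open>A \<alpha>\<close>. That set is read both as a cover by clopen sets and as the target that
  \<open>x \<alpha>\<close> has to agree with on infinitely many blocks, so no separate use of CH is needed.\<close>

definition guessed_points :: "(nat set \<Rightarrow> nat set set) \<Rightarrow> (nat \<Rightarrow> nat set) \<Rightarrow>
    (nat set \<Rightarrow> nat \<Rightarrow> bool) \<Rightarrow> nat set \<Rightarrow> (nat \<Rightarrow> bool) set"
  where "guessed_points A e x \<alpha> = x ` (A \<alpha> \<inter> underS omega1 \<alpha> - range e)"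

definition guessed_cover :: "(nat set \<Rightarrow> nat set set) \<Rightarrow> (nat \<Rightarrow> nat set) \<Rightarrow> nat set \<Rightarrow>
    (nat \<Rightarrow> bool) set set"
  where "guessed_cover A e \<alpha> = {from_nat_into clopens n | n. e n \<in> A \<alpha>}"

lemma clopens_nonempty: "clopens \<noteq> {}"
  using UNIV_clopen by blast

lemma guessed_cover_clopens: "guessed_cover A e \<alpha> \<subseteq> clopens"
  using from_nat_into[OF clopens_nonempty] by (auto simp: guessed_cover_def)

text \<open>Well-founded recursion on pairs of a family and a point: the conditions at \<alpha> look
  only at values below \<alpha>. Sets outside \<open>Field omega1\<close> have no predecessors, so
  they need no separate treatment.\<close>

lemma transfinite_construction:
  obtains L x where "\<And>\<alpha>. extends L \<alpha> (L \<alpha>)"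
    and "\<And>\<alpha>. captures (lower L \<alpha>) (guessed_points A e x \<alpha>) (guessed_cover A e \<alpha>) (L \<alpha>)"
    and "\<And>\<alpha>. x \<alpha> \<in> \<Union>(L \<alpha>)"
    and "\<And>\<alpha>. \<exists>\<^sub>\<infinity>n. \<forall>i\<in>{n * n..<Suc n * Suc n}. x \<alpha> i = (e i \<in> A \<alpha>)"
proof -
  define ok where "ok = (\<lambda>f \<alpha> r. extends (\<lambda>\<beta>. fst (f \<beta>)) \<alpha> (fst r) \<and>
    captures (lower (\<lambda>\<beta>. fst (f \<beta>)) \<alpha>) (guessed_points A e (\<lambda>\<beta>. snd (f \<beta>)) \<alpha>) (guessed_cover A e \<alpha>) (fst r) \<and>
    snd r \<in> \<Union>(fst r) \<and> (\<exists>\<^sub>\<infinity>n. \<forall>i\<in>{n * n..<Suc n * Suc n}. snd r i = (e i \<in> A \<alpha>)))"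
  have "\<exists>f. \<forall>\<alpha>. ok f \<alpha> (f \<alpha>)"
  proof (rule dependent_wf_choice[OF wf_underS_omega1])
    fix f g :: "nat set \<Rightarrow> (nat \<Rightarrow> bool) set set \<times> (nat \<Rightarrow> bool)"
      and \<alpha> and r :: "(nat \<Rightarrow> bool) set set \<times> (nat \<Rightarrow> bool)"
    assume "\<And>\<beta>. (\<beta>, \<alpha>) \<in> {(\<beta>, \<alpha>). \<beta> \<in> underS omega1 \<alpha>} \<Longrightarrow> f \<beta> = g \<beta>"
    then have eq: "f \<beta> = g \<beta>" if "\<beta> \<in> underS omega1 \<alpha>" for \<beta>
      using that by simp
    have "guessed_points A e (\<lambda>\<beta>. snd (f \<beta>)) \<alpha> = guessed_points A e (\<lambda>\<beta>. snd (g \<beta>)) \<alpha>"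
      unfolding guessed_points_def using eq by (intro image_cong) auto
    moreover have "lower (\<lambda>\<beta>. fst (f \<beta>)) \<alpha> = lower (\<lambda>\<beta>. fst (g \<beta>)) \<alpha>"
      by (rule lower_cong) (simp add: eq)
    moreover have "extends (\<lambda>\<beta>. fst (f \<beta>)) \<alpha> (fst r) = extends (\<lambda>\<beta>. fst (g \<beta>)) \<alpha> (fst r)"
      by (rule extends_cong) (simp add: eq)
    ultimately show "ok f \<alpha> r = ok g \<alpha> r"
      by (simp only: ok_def)
  next
    fix f :: "nat set \<Rightarrow> (nat \<Rightarrow> bool) set set \<times> (nat \<Rightarrow> bool)" and \<alpha>
    assume *: "\<And>\<beta>. (\<beta>, \<alpha>) \<in> {(\<beta>, \<alpha>). \<beta> \<in> underS omega1 \<alpha>} \<Longrightarrow> ok f \<beta> (f \<beta>)"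
    have below: "extends (\<lambda>\<beta>. fst (f \<beta>)) \<beta> (fst (f \<beta>))" if "\<beta> \<in> underS omega1 \<alpha>" for \<beta>
      using *[of \<beta>] that by (simp add: ok_def)
    have "countable (guessed_points A e (\<lambda>\<beta>. snd (f \<beta>)) \<alpha>)"
      unfolding guessed_points_def
      by (intro countable_image countable_subset[OF _ countable_underS_omega1[of \<alpha>]]) blast
    from stage_exists[where L = "\<lambda>\<beta>. fst (f \<beta>)" and z = "\<lambda>i. e i \<in> A \<alpha>",
        OF below this guessed_cover_clopens[of A e \<alpha>]]
    show "\<exists>r. ok f \<alpha> r"
      by (auto simp: ok_def)
  qed
  then obtain f where f: "\<And>\<alpha>. ok f \<alpha> (f \<alpha>)"
    by blast
  show ?thesis
    by (rule that[of "\<lambda>\<alpha>. fst (f \<alpha>)" "\<lambda>\<alpha>. snd (f \<alpha>)"]) (use f in \<open>auto simp: ok_def\<close>)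
qed

section \<open>The set of chosen points: covering by translates and the \<gamma>-property of its
  subsets\<close>

theorem theorem2p4:
  assumes "diamond"
  shows "\<exists>X :: (nat \<Rightarrow> bool) set. hereditarily_gamma_set X \<and> \<not> strongly_meager X"
proof -
  obtain A :: "nat set \<Rightarrow> nat set set" where
    A: "\<forall>Z\<subseteq>Field omega1. stationary_omega1 {\<alpha> \<in> Field omega1. Z \<inter> underS omega1 \<alpha> = A \<alpha>}"
    using assms unfolding diamond_def by blast
  have guess: "\<exists>\<alpha>\<in>C. Z \<inter> underS omega1 \<alpha> = A \<alpha>" if "Z \<subseteq> Field omega1" "club_omega1 C" for Z C
  proof -
    have "stationary_omega1 {\<alpha> \<in> Field omega1. Z \<inter> underS omega1 \<alpha> = A \<alpha>}"
      using A that(1) by simp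
    then have "{\<alpha> \<in> Field omega1. Z \<inter> underS omega1 \<alpha> = A \<alpha>} \<inter> C \<noteq> {}"
      using that(2) by (simp add: stationary_omega1_def)
    then show ?thesis
      by blast
  qed
  have "infinite (Field omega1)"
    using uncountable_omega1 by (rule uncountable_infinite)
  from infinite_countable_subset[OF this]
  obtain e :: "nat \<Rightarrow> nat set" where e: "inj e" "range e \<subseteq> Field omega1"
    by (elim exE conjE)
  \<comment> \<open>Guesses at ordinals above \<alpha>0 see all the reserved codes.\<close>
  obtain \<alpha>0 where \<alpha>0: "\<alpha>0 \<in> Field omega1" "range e \<subseteq> underS omega1 \<alpha>0"
    using countable_bounded_omega1[of "range e"] e(2) by auto
  obtain L x where L: "\<And>\<alpha>. extends L \<alpha> (L \<alpha>)"
    and capt: "\<And>\<alpha>. captures (lower L \<alpha>) (guessed_points A e x \<alpha>) (guessed_cover A e \<alpha>) (L \<alpha>)"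
    and x: "\<And>\<alpha>. x \<alpha> \<in> \<Union>(L \<alpha>)"
    and hits: "\<And>\<alpha>. \<exists>\<^sub>\<infinity>n. \<forall>i\<in>{n * n..<Suc n * Suc n}. x \<alpha> i = (e i \<in> A \<alpha>)"
    by (rule transfinite_construction[of A e]) blast
  define X where "X = x ` (Field omega1 - range e)"
  have above: "e n \<in> underS omega1 \<alpha>" "\<alpha> \<notin> range e" if "\<alpha>0 \<in> underS omega1 \<alpha>" for \<alpha> n
    using \<alpha>0(2) that underS_omega1_trans underS_omega1_irrefl by blast+
  have "cantor_sumset X vanishing = UNIV"
  proof (rule UNIV_eq_I[symmetric])
    fix z :: "nat \<Rightarrow> bool"
    have "e ` {n. z n} \<subseteq> Field omega1"
      using e(2) by blast
    \<comment> \<open>With \<open>g\<close> the identity the club is the final segment above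
      \<alpha>0, so some guess there decodes to \<open>z\<close>.\<close>
    from guess[OF this club_closure_points[of "\<lambda>\<beta>. \<beta>" \<alpha>0]] \<alpha>0(1)
    obtain \<alpha> where \<alpha>: "\<alpha> \<in> Field omega1" "\<alpha>0 \<in> underS omega1 \<alpha>" and
      A: "e ` {n. z n} \<inter> underS omega1 \<alpha> = A \<alpha>"
      by auto
    have "e n \<in> A \<alpha> \<longleftrightarrow> z n" for n
      using above(1)[OF \<alpha>(2)] e(1) by (auto simp: A[symmetric] dest: injD)
    then have "\<exists>\<^sub>\<infinity>n. \<forall>i\<in>{n * n..<Suc n * Suc n}. x \<alpha> i = z i"
      using hits[of \<alpha>] by simp
    then have "cantor_add (x \<alpha>) z \<in> vanishing"
      by (simp add: vanishing_def cantor_add_def)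
    moreover have "z = cantor_add (x \<alpha>) (cantor_add (x \<alpha>) z)"
      by (auto simp: cantor_add_def)
    moreover have "x \<alpha> \<in> X"
      using \<alpha> above(2) by (auto simp: X_def)
    ultimately show "z \<in> cantor_sumset X vanishing"
      unfolding cantor_sumset_def by blast
  qed
  then have "\<not> strongly_meager X"
    using cantor_null_vanishing unfolding strongly_meager_def by blast
  moreover have "gamma_set Y" if Y: "Y \<subseteq> X" for Y
    unfolding gamma_set_def
  proof (intro allI impI, elim conjE)
    fix \<J> assume cover: "omega_cover \<J> Y" and op: "\<forall>B\<in>\<J>. openin (top_of_set Y) B"
    define clp where "clp = from_nat_into clopens"
    have range_clp: "range clp = clopens"
      unfolding clp_def by (rule range_from_nat_into[OF clopens_nonempty countable_clopens])
    \<comment> \<open>\<open>W\<close> codes the cover by clopen sets whose trace on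
      \<open>Y\<close> lies inside a member; \<open>Z\<close> joins these codes with the indices of
      the points of \<open>Y\<close>.\<close>
    define W where "W = {n. \<exists>B\<in>\<J>. clp n \<inter> Y \<subseteq> B}"
    define S where "S = {\<xi> \<in> Field omega1 - range e. x \<xi> \<in> Y}"
    define Z where "Z = S \<union> e ` W"
    \<comment> \<open>The family is countable, so one index witnessing intersection with
      \<open>Y\<close> for each member gives a bounded set. Closure under the resulting
      \<open>g\<close> will yield reflection at \<alpha>.\<close>
    have "\<exists>b\<in>Field omega1. \<forall>P\<in>clopens \<union> L \<beta>. P \<inter> Y \<noteq> {} \<longrightarrow> (\<exists>\<xi>\<in>S \<inter> underS omega1 b. x \<xi> \<in> P)" for \<beta>
    proof -
      define \<P> where "\<P> = {P \<in> clopens \<union> L \<beta>. P \<inter> Y \<noteq> {}}"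
      have "\<exists>\<xi>\<in>S. x \<xi> \<in> P" if "P \<in> \<P>" for P
        using that Y by (auto simp: \<P>_def S_def X_def)
      then obtain h where h: "\<And>P. P \<in> \<P> \<Longrightarrow> h P \<in> S \<and> x (h P) \<in> P"
        by metis
      have "countable (clopens \<union> L \<beta>)"
        using L[of \<beta>] countable_clopens by (simp add: extends_def rich_def)
      then have "countable \<P>"
        by (rule countable_subset[rotated]) (auto simp: \<P>_def)
      then have "countable (h ` \<P>)"
        by (rule countable_image)
      moreover have "h ` \<P> \<subseteq> Field omega1"
        using h by (auto simp: S_def)
      ultimately obtain b where "b \<in> Field omega1" "h ` \<P> \<subseteq> underS omega1 b"
        using countable_bounded_omega1 by blast
      then show ?thesis
        using h by (intro bexI[of _ b]) (auto simp: \<P>_def)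
    qed
    then obtain g where g: "\<And>\<beta>. g \<beta> \<in> Field omega1"
      and gL: "\<And>\<beta> P. P \<in> clopens \<union> L \<beta> \<Longrightarrow> P \<inter> Y \<noteq> {} \<Longrightarrow> \<exists>\<xi>\<in>S \<inter> underS omega1 (g \<beta>). x \<xi> \<in> P"
      by metis
    have "Z \<subseteq> Field omega1"
      using e(2) by (auto simp: Z_def S_def)
    from guess[OF this club_closure_points[of g, OF g \<alpha>0(1)]]
    obtain \<alpha> where \<alpha>: "\<alpha> \<in> Field omega1" "\<alpha>0 \<in> underS omega1 \<alpha>"
      and closed: "\<And>\<beta>. \<beta> \<in> underS omega1 \<alpha> \<Longrightarrow> g \<beta> \<in> underS omega1 \<alpha>"
      and A: "Z \<inter> underS omega1 \<alpha> = A \<alpha>"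
      by blast
    define V where "V = x ` (S \<inter> underS omega1 \<alpha>)"
    have "A \<alpha> \<inter> underS omega1 \<alpha> - range e = S \<inter> underS omega1 \<alpha>"
      unfolding A[symmetric] by (auto simp: Z_def S_def)
    then have V: "guessed_points A e x \<alpha> = V"
      by (simp add: guessed_points_def V_def)
    have "e n \<in> A \<alpha> \<longleftrightarrow> n \<in> W" for n
      using above(1)[OF \<alpha>(2)] e(1) by (auto simp: A[symmetric] Z_def S_def dest: injD)
    then have C: "guessed_cover A e \<alpha> = clp ` W"
      by (auto simp: guessed_cover_def clp_def)
    have covered: "\<exists>C\<in>clp ` W. F \<subseteq> C" if F: "finite F" "F \<subseteq> V" for F
    proof -
      have FY: "F \<subseteq> Y"
        using F(2) by (auto simp: V_def S_def)
      then obtain B where B: "B \<in> \<J>" "F \<subseteq> B"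
        using cover F(1) unfolding omega_cover_def by blast
      then obtain U where U: "open U" "B = Y \<inter> U"
        using op by (auto simp: openin_open)
      obtain K where K: "K \<in> clopens" "F \<subseteq> K" "K \<subseteq> U"
        using clopen_between[OF U(1) F(1)] B(2) U(2) by blast
      have "K \<in> range clp"
        using K(1) range_clp by simp
      then obtain n where "K = clp n"
        by (rule rangeE)
      moreover have "K \<inter> Y \<subseteq> B"
        using K(3) U(2) by blast
      ultimately show ?thesis
        using K(2) B(1) unfolding W_def by blast
    qed
    have "reflects (lower L \<alpha>) V Y"
      unfolding reflects_def
    proof (intro ballI impI)
      fix P assume P: "P \<in> lower L \<alpha>" "P \<inter> Y \<noteq> {}"
      \<comment> \<open>For clopen \<open>P\<close> the ordinal \<alpha>0 can serve as
        \<beta>.\<close>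
      obtain \<beta> where \<beta>: "\<beta> \<in> underS omega1 \<alpha>" "P \<in> clopens \<union> L \<beta>"
        using P(1) \<alpha>(2) unfolding lower_def by blast
      obtain \<xi> where "\<xi> \<in> S \<inter> underS omega1 (g \<beta>)" "x \<xi> \<in> P"
        using gL[OF \<beta>(2) P(2)] by blast
      then have "x \<xi> \<in> P \<inter> V"
        using underS_omega1_trans closed[OF \<beta>(1)] unfolding V_def by blast
      then show "P \<inter> V \<noteq> {}"
        by blast
    qed
    then obtain D where D: "range D \<subseteq> clp ` W" "V \<subseteq> lim_inf D"
      and D_L: "\<And>Q. Q \<in> L \<alpha> \<Longrightarrow> Q \<inter> Y \<subseteq> lim_inf D"
      using capt[of \<alpha>] covered unfolding captures_def V C by metis
    have "Y \<subseteq> lim_inf D"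
    proof
      fix y assume y: "y \<in> Y"
      then obtain \<xi> where \<xi>: "\<xi> \<in> S" "y = x \<xi>"
        using Y by (auto simp: S_def X_def)
      show "y \<in> lim_inf D"
      proof (cases "\<xi> \<in> underS omega1 \<alpha>")
        case True
        then show ?thesis
          using D(2) \<xi> by (auto simp: V_def)
      next
        case False
        then have "\<xi> = \<alpha> \<or> \<alpha> \<in> underS omega1 \<xi>"
          using underS_omega1_total[of \<xi> \<alpha>] \<xi>(1) \<alpha>(1) by (auto simp: S_def)
        \<comment> \<open>Points chosen at stage \<alpha> or later still lie in the union of
          \<open>L \<alpha>\<close>, where the fusion controls all of \<open>Y\<close>.\<close>
        then have "\<Union>(L \<xi>) \<subseteq> \<Union>(L \<alpha>)"
          using L[of \<xi>] unfolding extends_def by blast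
        then show ?thesis
          using x[of \<xi>] \<xi>(2) D_L y by blast
      qed
    qed
    \<comment> \<open>The definition of \<open>W\<close> leads back from the clopen sets to members
      of the original cover.\<close>
    have "\<forall>n. \<exists>B\<in>\<J>. D n \<inter> Y \<subseteq> B"
    proof
      fix n
      obtain k where "k \<in> W" "D n = clp k"
        using D(1) by blast
      then show "\<exists>B\<in>\<J>. D n \<inter> Y \<subseteq> B"
        by (simp add: W_def)
    qed
    then obtain B where B: "\<And>n. B n \<in> \<J>" "\<And>n. D n \<inter> Y \<subseteq> B n"
      by metis
    have "Y \<subseteq> (\<Union>m. \<Inter>n\<in>{m<..}. B n)"
    proof
      fix y assume y: "y \<in> Y"
      then have "\<forall>\<^sub>F n in sequentially. y \<in> D n"
        using \<open>Y \<subseteq> lim_inf D\<close> by (auto simp: lim_inf_def)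
      then obtain m where "\<And>n. n \<ge> m \<Longrightarrow> y \<in> D n"
        by (auto simp: eventually_sequentially)
      then have "y \<in> (\<Inter>n\<in>{m<..}. B n)"
        using B(2) y by fastforce
      then show "y \<in> (\<Union>m. \<Inter>n\<in>{m<..}. B n)"
        by blast
    qed
    then show "\<exists>D :: nat \<Rightarrow> _. range D \<subseteq> \<J> \<and> Y \<subseteq> (\<Union>m. \<Inter>n\<in>{m<..}. D n)"
      using B(1) by (intro exI[of _ B]) blast
  qed
  ultimately show ?thesis
    unfolding hereditarily_gamma_set_def by blast
qed

end
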